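(* Let $Q,S\subset\mathbb Z$ be finite, let ${\bf A}=(\psi,\phi)$, $\psi:Q\times S^{\alpha+1}\to S$, $\phi:Q\times S^{\beta+1}\to Q$, be an automaton (not necessarily Mealy), choose a stable extension of ${\bf A}$ by relative $(\max,+)$-functions, and let $(f_t,g_t)$ be the corresponding relatively elementary functions. Let $\bar q^m=(q^0,\dots,q^m)\in Q^{m+1}$ and suppose that ${\bf A}_{\bar q^m}={\bf A}_{q^m}\circ\dots\circ{\bf A}_{q^0}:X_S\to X_S$ is of finite order with period $p$, i.e. $({\bf A}_{\bar q^m})^p=\mathrm{id}$. Then for any $C>0$ there exist $t_0>1$ and $D$, independent of the initial values, such that for all $t\ge t_0$, every $\bar k=(k_0,k_1,\dots)\in X_S$, and all positive initial values with $$C^{-1}t^{k_i}\le z_i\le C\,t^{k_i},\qquad C^{-1}t^{q^j}\le w^j\le C\,t^{q^j}\qquad(i,j\ge0),$$ where $(q^0,q^1,\dots)=\bar q^m_{per}$ is the infinite periodic repetition of $\bar q^m$, the solution of $$z_i^{j+1}=f_t(w_i^j,z_i^j,\dots,z_{i+\alpha}^j),\qquad w_{i+1}^j=g_t(w_i^j,z_i^j,\dots,z_{i+\beta}^j),\qquad z_i^0=z_i,\ w_0^j=w^j,$$ satisfies $$\Big(\frac{z_i^j}{z_i^{j+p(m+1)l}}\Big)^{\pm1}\le D\qquad\text{for all } i,j,l=0,1,2,\dots$$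
   Context: $(a)^{\pm1}$ denotes $\max(a,1/a)$. $X_S$ is the set of infinite sequences in $S$. For $q\in Q$ the map ${\bf A}_q:X_S\to X_S$, ${\bf A}_q(s_0,s_1,\dots)=(s_0',s_1',\dots)$, is defined by $q_0=q$, $s_i'=\psi(q_i,s_i,\dots,s_{i+\alpha})$, $q_{i+1}=\phi(q_i,s_i,\dots,s_{i+\beta})$. A relative $(\max,+)$-function of $n$ variables is a function $\varphi:\mathbb R^n\to\mathbb R$ together with a presentation $\varphi(\bar x)=\max_k(\alpha_k+\bar a_k\cdot\bar x)-\max_k(\beta_k+\bar b_k\cdot\bar x)$ (finite maxima, $\alpha_k,\beta_k\in\mathbb R$, $\bar a_k,\bar b_k\in\mathbb Q^n$); for $t>1$ the corresponding relatively elementary function is $f_t(\bar z)=\dfrac{\sum_k t^{\alpha_k}\bar z^{\bar a_k}}{\sum_k t^{\beta_k}\bar z^{\bar b_k}}$ on $(0,\infty)^n$, with $\bar z^{\bar a}=\prod_i z_i^{a^i}$. A stable extension of an automaton is a pair of relative $(\max,+)$-functions $\psi:\mathbb R\times\mathbb R^{\alpha+1}\to\mathbb R$, $\phi:\mathbb R\times\mathbb R^{\beta+1}\to\mathbb R$ restricting to the given maps on $Q\times S^{\alpha+1}$, $Q\times S^{\beta+1}$, such that for some $0<\delta<1$, $0\le\mu<1$ both are Lipschitz with constant at most $\mu$ (sup-norm metric) on the $\delta$-neighbourhood of each point of $Q\times S^{\alpha+1}$, respectively $Q\times S^{\beta+1}$. *)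

theory Defs
  imports Complex_Main
begin

text \<open>
  Tuples are lists: an element of \<open>A\<^sup>n\<close> is a list of length \<open>n\<close> with entries in \<open>A\<close>, and a point
  \<open>(q, s\<^sub>0, \<dots>, s\<^sub>\<alpha>)\<close> of \<open>A \<times> B\<^bsup>\<alpha>+1\<^esup>\<close>, seen as an argument of a function of \<open>\<alpha> + 2\<close>
  variables, is the list \<open>q # [s\<^sub>0, \<dots>, s\<^sub>\<alpha>]\<close>.
\<close>

definition tuples :: "nat \<Rightarrow> 'a set \<Rightarrow> 'a list set" where
  "tuples n A = {u. length u = n \<and> set u \<subseteq> A}"

definition seqs :: "'a set \<Rightarrow> (nat \<Rightarrow> 'a) set" where
  "seqs S = {s. \<forall>i. s i \<in> S}"

text \<open>The window \<open>(s\<^sub>i, \<dots>, s\<^bsub>i+a\<^esub>)\<close> of length \<open>a + 1\<close>.\<close>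

definition window :: "(nat \<Rightarrow> 'a) \<Rightarrow> nat \<Rightarrow> nat \<Rightarrow> 'a list" where
  "window s i a = map s [i..<i + a + 1]"

section \<open>Automata\<close>

text \<open>Only the values of \<open>\<psi>\<close> on \<open>Q \<times> S\<^bsup>\<alpha>+1\<^esup>\<close> and of \<open>\<phi>\<close> on \<open>Q \<times> S\<^bsup>\<beta>+1\<^esup>\<close> are meaningful.\<close>

definition automaton ::
  "int set \<Rightarrow> int set \<Rightarrow> nat \<Rightarrow> nat \<Rightarrow> (int \<Rightarrow> int list \<Rightarrow> int) \<Rightarrow> (int \<Rightarrow> int list \<Rightarrow> int) \<Rightarrow> bool" where
  "automaton Q S \<alpha> \<beta> \<psi> \<phi> \<longleftrightarrow>
     finite Q \<and> finite S \<and>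
     (\<forall>q\<in>Q. \<forall>u\<in>tuples (\<alpha> + 1) S. \<psi> q u \<in> S) \<and>
     (\<forall>q\<in>Q. \<forall>u\<in>tuples (\<beta> + 1) S. \<phi> q u \<in> Q)"

primrec aut_state :: "nat \<Rightarrow> (int \<Rightarrow> int list \<Rightarrow> int) \<Rightarrow> int \<Rightarrow> (nat \<Rightarrow> int) \<Rightarrow> nat \<Rightarrow> int" where
  "aut_state \<beta> \<phi> q s 0 = q"
| "aut_state \<beta> \<phi> q s (Suc i) = \<phi> (aut_state \<beta> \<phi> q s i) (window s i \<beta>)"

definition aut_map ::
  "nat \<Rightarrow> nat \<Rightarrow> (int \<Rightarrow> int list \<Rightarrow> int) \<Rightarrow> (int \<Rightarrow> int list \<Rightarrow> int) \<Rightarrow> int \<Rightarrow> (nat \<Rightarrow> int) \<Rightarrow> (nat \<Rightarrow> int)" where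
  "aut_map \<alpha> \<beta> \<psi> \<phi> q s = (\<lambda>i. \<psi> (aut_state \<beta> \<phi> q s i) (window s i \<alpha>))"

text \<open>The head of the list acts first: on \<open>[q\<^sup>0, \<dots>, q\<^sup>m]\<close> this is
  \<open>A\<^bsub>q\<^sup>m\<^esub> \<circ> \<dots> \<circ> A\<^bsub>q\<^sup>0\<^esub>\<close>.\<close>

definition aut_comp ::
  "nat \<Rightarrow> nat \<Rightarrow> (int \<Rightarrow> int list \<Rightarrow> int) \<Rightarrow> (int \<Rightarrow> int list \<Rightarrow> int) \<Rightarrow> int list \<Rightarrow> (nat \<Rightarrow> int) \<Rightarrow> (nat \<Rightarrow> int)" where
  "aut_comp \<alpha> \<beta> \<psi> \<phi> qs = fold (aut_map \<alpha> \<beta> \<psi> \<phi>) qs"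

section \<open>Relative (max,+)-functions and relatively elementary functions\<close>

text \<open>
  A term \<open>(c, a)\<close> stands for the affine function \<open>c + a \<cdot> x\<close>, respectively for the monomial
  \<open>t\<^sup>c z\<^sup>a\<close>. Terms are collected in lists rather than sets because a repeated term,
  though invisible in the maximum, counts with its multiplicity in the sum.
\<close>

type_synonym mp_term = "real \<times> rat list"

datatype rel_maxplus = Rel_Maxplus (plus_terms: "mp_term list") (minus_terms: "mp_term list")

definition rel_maxplus_fun :: "nat \<Rightarrow> rel_maxplus \<Rightarrow> bool" where
  "rel_maxplus_fun n F \<longleftrightarrow>
     plus_terms F \<noteq> [] \<and> minus_terms F \<noteq> [] \<and>
     (\<forall>(c, a) \<in> set (plus_terms F) \<union> set (minus_terms F). length a = n)"

definition affine_term :: "mp_term \<Rightarrow> real list \<Rightarrow> real" where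
  "affine_term T x = fst T + (\<Sum>i<length x. real_of_rat (snd T ! i) * x ! i)"

definition mp_eval :: "rel_maxplus \<Rightarrow> real list \<Rightarrow> real" where
  "mp_eval F x =
     Max ((\<lambda>T. affine_term T x) ` set (plus_terms F)) -
     Max ((\<lambda>T. affine_term T x) ` set (minus_terms F))"

definition monomial_term :: "real \<Rightarrow> mp_term \<Rightarrow> real list \<Rightarrow> real" where
  "monomial_term t T z = t powr fst T * (\<Prod>i<length z. z ! i powr real_of_rat (snd T ! i))"

definition elem_eval :: "real \<Rightarrow> rel_maxplus \<Rightarrow> real list \<Rightarrow> real" where
  "elem_eval t F z =
     (\<Sum>T\<leftarrow>plus_terms F. monomial_term t T z) / (\<Sum>T\<leftarrow>minus_terms F. monomial_term t T z)"

section \<open>Stable extensions\<close>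

definition sup_dist :: "real list \<Rightarrow> real list \<Rightarrow> real" where
  "sup_dist x y = Max ((\<lambda>i. \<bar>x ! i - y ! i\<bar>) ` {..<length x})"

definition sup_ball :: "real list \<Rightarrow> real \<Rightarrow> real list set" where
  "sup_ball c \<delta> = {x. length x = length c \<and> sup_dist x c < \<delta>}"

definition sup_lipschitz_on :: "real \<Rightarrow> real list set \<Rightarrow> (real list \<Rightarrow> real) \<Rightarrow> bool" where
  "sup_lipschitz_on \<mu> X f \<longleftrightarrow> (\<forall>x\<in>X. \<forall>y\<in>X. \<bar>f x - f y\<bar> \<le> \<mu> * sup_dist x y)"

text \<open>\<open>F\<close> extends \<open>h : Q \<times> S\<^sup>n \<rightarrow> \<int>\<close> and is Lipschitz near the points of \<open>Q \<times> S\<^sup>n\<close>.\<close>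

definition stable_ext_fun ::
  "real \<Rightarrow> real \<Rightarrow> int set \<Rightarrow> int set \<Rightarrow> nat \<Rightarrow> (int \<Rightarrow> int list \<Rightarrow> int) \<Rightarrow> rel_maxplus \<Rightarrow> bool" where
  "stable_ext_fun \<delta> \<mu> Q S n h F \<longleftrightarrow>
     rel_maxplus_fun (n + 1) F \<and>
     (\<forall>q\<in>Q. \<forall>u\<in>tuples n S.
        mp_eval F (map real_of_int (q # u)) = real_of_int (h q u) \<and>
        sup_lipschitz_on \<mu> (sup_ball (map real_of_int (q # u)) \<delta>) (mp_eval F))"

definition stable_extension ::
  "int set \<Rightarrow> int set \<Rightarrow> nat \<Rightarrow> nat \<Rightarrow> (int \<Rightarrow> int list \<Rightarrow> int) \<Rightarrow> (int \<Rightarrow> int list \<Rightarrow> int)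
     \<Rightarrow> rel_maxplus \<Rightarrow> rel_maxplus \<Rightarrow> bool" where
  "stable_extension Q S \<alpha> \<beta> \<psi> \<phi> F G \<longleftrightarrow>
     (\<exists>\<delta> \<mu>. 0 < \<delta> \<and> \<delta> < 1 \<and> 0 \<le> \<mu> \<and> \<mu> < 1 \<and>
        stable_ext_fun \<delta> \<mu> Q S (\<alpha> + 1) \<psi> F \<and> stable_ext_fun \<delta> \<mu> Q S (\<beta> + 1) \<phi> G)"

section \<open>The discrete dynamics\<close>

text \<open>Here \<open>Z i j\<close> and \<open>W i j\<close> stand for \<open>z\<^sub>i\<^sup>j\<close> and \<open>w\<^sub>i\<^sup>j\<close>; \<open>z\<close> and \<open>w\<close> are the initial values.\<close>

definition is_solution ::
  "nat \<Rightarrow> nat \<Rightarrow> (real list \<Rightarrow> real) \<Rightarrow> (real list \<Rightarrow> real) \<Rightarrow> (nat \<Rightarrow> real) \<Rightarrow> (nat \<Rightarrow> real)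
     \<Rightarrow> (nat \<Rightarrow> nat \<Rightarrow> real) \<Rightarrow> (nat \<Rightarrow> nat \<Rightarrow> real) \<Rightarrow> bool" where
  "is_solution \<alpha> \<beta> f g z w Z W \<longleftrightarrow>
     (\<forall>i j. Z i (j + 1) = f (W i j # window (\<lambda>k. Z k j) i \<alpha>)) \<and>
     (\<forall>i j. W (i + 1) j = g (W i j # window (\<lambda>k. Z k j) i \<beta>)) \<and>
     (\<forall>i. Z i 0 = z i) \<and> (\<forall>j. W 0 j = w j)"

definition pm_max :: "real \<Rightarrow> real" where
  "pm_max a = max a (1 / a)"

text \<open>There is exactly one solution for all initial values, so quantifying universally
  over the solutions speaks about ``the'' solution.\<close>

lemma is_solution_exists: "\<exists>Z W. is_solution \<alpha> \<beta> f g z w Z W"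
proof -
  define Wr where "Wr = (\<lambda>r w0. rec_nat w0 (\<lambda>i v. g (v # window r i \<beta>)) :: nat \<Rightarrow> real)"
  define R where "R = rec_nat z (\<lambda>j r i. f (Wr r (w j) i # window r i \<alpha>))"
  have "is_solution \<alpha> \<beta> f g z w (\<lambda>i j. R j i) (\<lambda>i j. Wr (R j) (w j) i)"
    by (simp add: is_solution_def R_def Wr_def)
  then show ?thesis by blast
qed

lemma is_solution_unique:
  assumes "is_solution \<alpha> \<beta> f g z w Z W" and "is_solution \<alpha> \<beta> f g z w Z' W'"
  shows "Z = Z'" and "W = W'"
proof -
  have W: "W i j = W' i j" if "\<And>k. Z k j = Z' k j" for i j
    using assms that by (induction i) (auto simp: is_solution_def)
  have Z: "Z i j = Z' i j" for i j
  proof (induction j arbitrary: i)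
    case 0
    then show ?case using assms by (simp add: is_solution_def)
  next
    case (Suc j)
    then show ?case using assms W[of j] by (simp add: is_solution_def)
  qed
  then show "Z = Z'" and "W = W'" using W by (blast intro: ext)+
qed

end

theory Submission
  imports Defs
begin

text \<open>
  In the coordinate \<open>x = log\<^sub>t z\<close> the relatively elementary function differs from its
  (max,+)-function by \<open>O(1 / ln t)\<close>. If the orbit is \<open>M / ln t\<close>-close to the automaton orbit,
  the contraction factor \<open>\<mu> < 1\<close> turns the error of one step into
  \<open>(L + \<mu> * M) / ln t\<close>, and this is at most \<open>M / ln t\<close> once \<open>M \<ge> L / (1 - \<mu>)\<close>. So the
  logarithmic orbit shadows the automaton orbit for all times, and the latter is periodic.
\<close>

section \<open>Elementary functions compared with (max,+)-functions in logarithmic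
  coordinates\<close>

lemma sum_list_powr_bounds:
  fixes f :: "'a \<Rightarrow> real"
  assumes "xs \<noteq> []" "t > 1"
  shows "t powr Max (f ` set xs) \<le> (\<Sum>x\<leftarrow>xs. t powr f x)"
    and "(\<Sum>x\<leftarrow>xs. t powr f x) \<le> real (length xs) * t powr Max (f ` set xs)"
proof -
  have "Max (f ` set xs) \<in> f ` set xs"
    using assms by (intro Max_in) auto
  then obtain y where y: "y \<in> set xs" "Max (f ` set xs) = f y"
    by blast
  have "t powr f y \<in> set (map (\<lambda>x. t powr f x) xs)"
    using y by simp
  moreover have "\<And>x. x \<in> set (map (\<lambda>x. t powr f x) xs) \<Longrightarrow> 0 \<le> x"
    by auto
  ultimately show "t powr Max (f ` set xs) \<le> (\<Sum>x\<leftarrow>xs. t powr f x)"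
    unfolding y(2) by (rule member_le_sum_list)
  have "(\<Sum>x\<leftarrow>xs. t powr f x) \<le> (\<Sum>x\<leftarrow>xs. t powr Max (f ` set xs))"
    using assms by (intro sum_list_mono powr_mono) auto
  then show "(\<Sum>x\<leftarrow>xs. t powr f x) \<le> real (length xs) * t powr Max (f ` set xs)"
    by (simp add: sum_list_triv)
qed

text \<open>Taking logarithms turns the factor \<open>length xs\<close> into an additive error
  \<open>ln (length xs) / ln t\<close>, which does not depend on the exponents and vanishes as
  \<open>t\<close> grows.\<close>

lemma log_sum_list_powr_bounds:
  fixes f :: "'a \<Rightarrow> real"
  assumes "xs \<noteq> []" "t > 1"
  shows "(\<Sum>x\<leftarrow>xs. t powr f x) > 0"
    and "Max (f ` set xs) \<le> log t (\<Sum>x\<leftarrow>xs. t powr f x)"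
    and "log t (\<Sum>x\<leftarrow>xs. t powr f x) \<le> log t (length xs) + Max (f ` set xs)"
proof -
  note b = sum_list_powr_bounds[OF assms, of f]
  show pos: "(\<Sum>x\<leftarrow>xs. t powr f x) > 0"
    using b(1) assms(2) by (smt (verit) powr_gt_zero)
  show "Max (f ` set xs) \<le> log t (\<Sum>x\<leftarrow>xs. t powr f x)"
    using b(1) pos assms(2) by (subst le_log_iff) auto
  have "log t (\<Sum>x\<leftarrow>xs. t powr f x) \<le> log t (real (length xs) * t powr Max (f ` set xs))"
    using b(2) pos assms by (subst log_le_cancel_iff) auto
  also have "\<dots> = log t (length xs) + Max (f ` set xs)"
    using assms by (subst log_mult) auto
  finally show "log t (\<Sum>x\<leftarrow>xs. t powr f x) \<le> log t (length xs) + Max (f ` set xs)" .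
qed

text \<open>Each \<open>z ! i\<close> is \<open>t powr log t (z ! i)\<close>, so the exponents add
  up. All monomials become powers of the one base \<open>t\<close>, as the bounds above
  require.\<close>

lemma monomial_term_eq_powr:
  assumes "t > 1" "\<forall>x\<in>set z. x > 0"
  shows "monomial_term t T z = t powr affine_term T (map (log t) z)"
proof -
  have "z ! i powr real_of_rat (snd T ! i) = t powr (real_of_rat (snd T ! i) * log t (z ! i))"
    if "i < length z" for i
  proof -
    have "z ! i > 0"
      using assms(2) that by simp
    then show ?thesis
      using assms(1) by (simp add: powr_def log_def)
  qed
  then have "(\<Prod>i<length z. z ! i powr real_of_rat (snd T ! i))
      = t powr (\<Sum>i<length z. real_of_rat (snd T ! i) * log t (z ! i))"
    using assms(1) by (simp add: powr_sum)
  moreover have "(\<Sum>i<length z. real_of_rat (snd T ! i) * map (log t) z ! i)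
      = (\<Sum>i<length z. real_of_rat (snd T ! i) * log t (z ! i))"
    by (intro sum.cong) auto
  ultimately show ?thesis
    by (simp add: monomial_term_def affine_term_def powr_add)
qed

definition num_terms :: "rel_maxplus \<Rightarrow> nat" where
  "num_terms F = length (plus_terms F) + length (minus_terms F)"

text \<open>The logarithms of numerator and denominator both err only upwards from their maxima. In
  the difference these errors have opposite signs, so the larger one bounds the total.\<close>

lemma log_elem_eval_approx:
  assumes "rel_maxplus_fun n F" "t > 1" "\<forall>x\<in>set z. x > 0"
  shows "elem_eval t F z > 0"
    and "\<bar>log t (elem_eval t F z) - mp_eval F (map (log t) z)\<bar> \<le> log t (num_terms F)"
proof -
  have ne: "plus_terms F \<noteq> []" "minus_terms F \<noteq> []"
    using assms(1) by (auto simp: rel_maxplus_fun_def)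
  note bp = log_sum_list_powr_bounds[OF ne(1) assms(2), of "\<lambda>T. affine_term T (map (log t) z)"]
  note bm = log_sum_list_powr_bounds[OF ne(2) assms(2), of "\<lambda>T. affine_term T (map (log t) z)"]
  have e: "elem_eval t F z =
      (\<Sum>T\<leftarrow>plus_terms F. t powr affine_term T (map (log t) z)) /
      (\<Sum>T\<leftarrow>minus_terms F. t powr affine_term T (map (log t) z))"
    unfolding elem_eval_def by (simp add: monomial_term_eq_powr[OF assms(2,3)])
  show "elem_eval t F z > 0"
    unfolding e using bp(1) bm(1) by simp
  have "log t (length (plus_terms F)) \<le> log t (num_terms F)"
    "log t (length (minus_terms F)) \<le> log t (num_terms F)"
    using ne assms(2) by (auto simp: num_terms_def intro!: log_mono)
  moreover have "log t (elem_eval t F z) =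
      log t (\<Sum>T\<leftarrow>plus_terms F. t powr affine_term T (map (log t) z)) -
      log t (\<Sum>T\<leftarrow>minus_terms F. t powr affine_term T (map (log t) z))"
    unfolding e using bp(1) bm(1) by (simp add: log_divide)
  ultimately show "\<bar>log t (elem_eval t F z) - mp_eval F (map (log t) z)\<bar> \<le> log t (num_terms F)"
    unfolding mp_eval_def using bp(2,3) bm(2,3) by linarith
qed

section \<open>Error of one step near the automaton\<close>

lemma sup_dist_le_iff:
  assumes "x \<noteq> []"
  shows "sup_dist x y \<le> e \<longleftrightarrow> (\<forall>i<length x. \<bar>x ! i - y ! i\<bar> \<le> e)"
  using assms unfolding sup_dist_def by (subst Max_le_iff) auto

text \<open>The value at the centre of the ball is exactly \<open>h q u\<close>, so the Lipschitz
  bound between \<open>x\<close> and the centre shrinks the input error by the factor \<mu>.\<close>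

lemma stable_ext_fun_error:
  assumes "stable_ext_fun \<delta> \<mu> Q S n h F" "\<delta> > 0" "\<mu> \<ge> 0"
    and "q \<in> Q" "u \<in> tuples n S"
    and "length x = n + 1" "\<forall>i<n + 1. \<bar>x ! i - real_of_int ((q # u) ! i)\<bar> \<le> e" "e < \<delta>"
  shows "\<bar>mp_eval F x - h q u\<bar> \<le> \<mu> * e"
proof -
  define c where "c = map real_of_int (q # u)"
  have len: "length c = n + 1"
    using assms(5) by (simp add: c_def tuples_def)
  have d: "sup_dist x c \<le> e"
    using assms(6,7) len by (subst sup_dist_le_iff) (auto simp: c_def simp del: list.map)
  \<comment> \<open>The Lipschitz bound compares two points of the ball, so the centre has to be
    shown to belong to it too.\<close>
  have "sup_dist c c \<le> 0"
    using len by (subst sup_dist_le_iff) auto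
  then have "x \<in> sup_ball c \<delta>" "c \<in> sup_ball c \<delta>"
    using d assms(2,6,8) len by (auto simp: sup_ball_def)
  moreover have "sup_lipschitz_on \<mu> (sup_ball c \<delta>) (mp_eval F)" "mp_eval F c = h q u"
    using assms(1,4,5) unfolding stable_ext_fun_def c_def by blast+
  ultimately have "\<bar>mp_eval F x - h q u\<bar> \<le> \<mu> * sup_dist x c"
    unfolding sup_lipschitz_on_def by metis
  also have "\<dots> \<le> \<mu> * e"
    using d assms(3) by (rule mult_left_mono)
  finally show ?thesis .
qed

lemma window_in_tuples: "s \<in> seqs S \<Longrightarrow> window s i a \<in> tuples (a + 1) S"
  by (auto simp: window_def tuples_def seqs_def)

text \<open>The error of one step is the approximation error plus the contracted input error. A
  generic \<open>h\<close> lets this serve both the output and the state recursion.\<close>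

lemma elem_eval_window_error:
  fixes z :: "nat \<Rightarrow> real"
  assumes "stable_ext_fun \<delta> \<mu> Q S (a + 1) h F" "\<delta> > 0" "\<mu> \<ge> 0" "e < \<delta>" "t > 1"
    and "q \<in> Q" "s \<in> seqs S"
    and "w > 0" "\<bar>log t w - q\<bar> \<le> e"
    and "\<And>k. z k > 0 \<and> \<bar>log t (z k) - s k\<bar> \<le> e"
  shows "elem_eval t F (w # window z i a) > 0 \<and>
    \<bar>log t (elem_eval t F (w # window z i a)) - h q (window s i a)\<bar> \<le> log t (num_terms F) + \<mu> * e"
proof -
  have pos: "\<forall>x\<in>set (w # window z i a). x > 0"
    using assms(8,10) by (auto simp: window_def)
  have F: "rel_maxplus_fun (a + 1 + 1) F"
    using assms(1) by (simp add: stable_ext_fun_def)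
  have "\<bar>mp_eval F (map (log t) (w # window z i a)) - h q (window s i a)\<bar> \<le> \<mu> * e"
  proof (rule stable_ext_fun_error[OF assms(1-3,6) window_in_tuples[OF assms(7)] _ _ assms(4)])
    show "length (map (log t) (w # window z i a)) = a + 1 + 1"
      by (simp add: window_def)
    show "\<forall>l<a + 1 + 1. \<bar>map (log t) (w # window z i a) ! l -
        real_of_int ((q # window s i a) ! l)\<bar> \<le> e"
    proof (intro allI impI)
      fix l assume "l < a + 1 + 1"
      then show "\<bar>map (log t) (w # window z i a) ! l - real_of_int ((q # window s i a) ! l)\<bar> \<le> e"
        using assms(9,10) by (cases l) (auto simp: window_def nth_append simp del: upt_Suc)
    qed
  qed
  with log_elem_eval_approx[OF F assms(5) pos] show ?thesis
    by linarith
qed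

section \<open>Orbits of the automaton and their periodicity\<close>

lemma aut_state_in:
  assumes "automaton Q S \<alpha> \<beta> \<psi> \<phi>" "q \<in> Q" "s \<in> seqs S"
  shows "aut_state \<beta> \<phi> q s i \<in> Q"
  using assms window_in_tuples[OF assms(3)] by (induction i) (auto simp: automaton_def)

lemma aut_map_in_seqs:
  assumes "automaton Q S \<alpha> \<beta> \<psi> \<phi>" "q \<in> Q" "s \<in> seqs S"
  shows "aut_map \<alpha> \<beta> \<psi> \<phi> q s \<in> seqs S"
  using assms aut_state_in[OF assms] window_in_tuples[OF assms(3), of _ \<alpha>]
  by (auto simp: automaton_def aut_map_def seqs_def[of S])

text \<open>The word \<open>qs\<close> is read cyclically, one letter per time step. The maps are
  left abstract because periodicity uses nothing about automata.\<close>

primrec periodic_orbit :: "('q \<Rightarrow> 'x \<Rightarrow> 'x) \<Rightarrow> 'q list \<Rightarrow> 'x \<Rightarrow> nat \<Rightarrow> 'x" where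
  "periodic_orbit A qs x 0 = x"
| "periodic_orbit A qs x (Suc j) = A (qs ! (j mod length qs)) (periodic_orbit A qs x j)"

text \<open>After whole passes through the word the letter index \<open>j mod length qs\<close>
  starts afresh.\<close>

lemma periodic_orbit_add_mult:
  "periodic_orbit A qs x (length qs * n + j) = periodic_orbit A qs (periodic_orbit A qs x (length qs * n)) j"
  by (induction j) auto

text \<open>During the first pass \<open>j mod length qs\<close> is \<open>j\<close> itself, so the
  letters are read in the order used by \<open>fold\<close>.\<close>

lemma periodic_orbit_le_length:
  "j \<le> length qs \<Longrightarrow> periodic_orbit A qs x j = fold A (take j qs) x"
  by (induction j) (auto simp: take_Suc_conv_app_nth)

lemma periodic_orbit_mult: "periodic_orbit A qs x (length qs * n) = (fold A qs ^^ n) x"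
proof (induction n)
  case (Suc n)
  have "periodic_orbit A qs x (length qs * Suc n) = periodic_orbit A qs x (length qs * n + length qs)"
    by (simp add: add.commute)
  also have "\<dots> = fold A qs (periodic_orbit A qs x (length qs * n))"
    by (simp only: periodic_orbit_add_mult) (simp add: periodic_orbit_le_length)
  finally show ?case
    using Suc by simp
qed simp

lemma periodic_orbit_period:
  assumes "(fold A qs ^^ p) x = x"
  shows "periodic_orbit A qs x (j + p * length qs * l) = periodic_orbit A qs x j"
proof -
  have "(fold A qs ^^ (p * l)) x = x"
    using assms by (induction l) (auto simp: funpow_add)
  then have "periodic_orbit A qs x (length qs * (p * l)) = x"
    by (simp only: periodic_orbit_mult)
  then show ?thesis
    using periodic_orbit_add_mult[of A qs x "p * l" j] by (simp add: ac_simps)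
qed

lemma periodic_orbit_in_seqs:
  assumes "automaton Q S \<alpha> \<beta> \<psi> \<phi>" "set qs \<subseteq> Q" "qs \<noteq> []" "k \<in> seqs S"
  shows "periodic_orbit (aut_map \<alpha> \<beta> \<psi> \<phi>) qs k j \<in> seqs S"
proof (induction j)
  case (Suc j)
  have "qs ! (j mod length qs) \<in> Q"
    using assms(2,3) by (meson length_greater_0_conv mod_less_divisor nth_mem subsetD)
  then show ?case
    using Suc assms(1) by (simp add: aut_map_in_seqs)
qed (use assms in simp)

text \<open>By \<open>eF\<close> and \<open>eG\<close> a single step reproduces the radius
  \<open>e\<close>, so errors accumulate neither in time nor along the positions. The induction on
  time treats all positions at once, since a window looks to the right.\<close>

lemma solution_shadows_automaton:
  assumes aut: "automaton Q S \<alpha> \<beta> \<psi> \<phi>"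
    and F: "stable_ext_fun \<delta> \<mu> Q S (\<alpha> + 1) \<psi> F" and G: "stable_ext_fun \<delta> \<mu> Q S (\<beta> + 1) \<phi> G"
    and \<delta>\<mu>: "\<delta> > 0" "\<mu> \<ge> 0" and "e < \<delta>" "t > 1"
    and eF: "log t (num_terms F) + \<mu> * e \<le> e" and eG: "log t (num_terms G) + \<mu> * e \<le> e"
    and qs: "set qs \<subseteq> Q" "qs \<noteq> []" and k: "k \<in> seqs S"
    and sol: "is_solution \<alpha> \<beta> (elem_eval t F) (elem_eval t G) z w Z W"
    and z: "\<And>i. z i > 0 \<and> \<bar>log t (z i) - k i\<bar> \<le> e"
    and w: "\<And>j. w j > 0 \<and> \<bar>log t (w j) - qs ! (j mod length qs)\<bar> \<le> e"
  shows "Z i j > 0 \<and> \<bar>log t (Z i j) - periodic_orbit (aut_map \<alpha> \<beta> \<psi> \<phi>) qs k j i\<bar> \<le> e"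
proof (induction j arbitrary: i)
  case 0
  then show ?case
    using sol z by (simp add: is_solution_def)
next
  case (Suc j)
  define s where "s = periodic_orbit (aut_map \<alpha> \<beta> \<psi> \<phi>) qs k j"
  define q where "q = qs ! (j mod length qs)"
  have s: "s \<in> seqs S"
    unfolding s_def by (rule periodic_orbit_in_seqs[OF aut qs k])
  have "q \<in> Q"
    unfolding q_def using qs by (meson length_greater_0_conv mod_less_divisor nth_mem subsetD)
  note st = aut_state_in[OF aut this s]
  note IH = Suc.IH[folded s_def]
  \<comment> \<open>At fixed time the states are controlled by an inner induction on the position,
    starting at the boundary value \<open>w j\<close>. This precedes the claim on \<open>Z\<close>,
    whose next row depends on these states.\<close>
  have W: "W i j > 0 \<and> \<bar>log t (W i j) - aut_state \<beta> \<phi> q s i\<bar> \<le> e" for i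
  proof (induction i)
    case 0
    then show ?case
      using sol w by (simp add: is_solution_def q_def)
  next
    case (Suc i)
    have "W (Suc i) j = elem_eval t G (W i j # window (\<lambda>k. Z k j) i \<beta>)"
      using sol by (simp add: is_solution_def)
    then show ?case
      using elem_eval_window_error[OF G \<delta>\<mu> \<open>e < \<delta>\<close> \<open>t > 1\<close> st s conjunct1[OF Suc.IH]
          conjunct2[OF Suc.IH] IH, of i] eG
      by simp
  qed
  have "Z i (Suc j) = elem_eval t F (W i j # window (\<lambda>k. Z k j) i \<alpha>)"
    using sol by (simp add: is_solution_def)
  moreover have "periodic_orbit (aut_map \<alpha> \<beta> \<psi> \<phi>) qs k (Suc j) i
      = \<psi> (aut_state \<beta> \<phi> q s i) (window s i \<alpha>)"
    by (simp add: s_def q_def aut_map_def)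
  ultimately show ?case
    using elem_eval_window_error[OF F \<delta>\<mu> \<open>e < \<delta>\<close> \<open>t > 1\<close> st s conjunct1[OF W] conjunct2[OF W] IH,
        of i i] eF
    by simp
qed

section \<open>From logarithmic back to multiplicative bounds\<close>

lemma abs_log_diff_le:
  fixes t C z x :: real
  assumes "t > 1" "C > 0" "z > 0" "inverse C * t powr x \<le> z" "z \<le> C * t powr x"
  shows "\<bar>log t z - x\<bar> \<le> log t C"
proof -
  have "log t (inverse C * t powr x) \<le> log t z" "log t z \<le> log t (C * t powr x)"
    using assms by auto
  moreover have "log t (inverse C * t powr x) = x - log t C" "log t (C * t powr x) = x + log t C"
    using assms by (auto simp: log_mult log_inverse)
  ultimately show ?thesis
    by linarith
qed

text \<open>Closeness \<open>M / ln t\<close> in base-\<open>t\<close> logarithms is closeness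
  \<open>M\<close> in natural ones. The base cancels, and the bound does not depend on
  \<open>t\<close>.\<close>

lemma pm_max_divide_le:
  assumes "t > 1" "a > 0" "b > 0" "\<bar>log t a - x\<bar> \<le> M / ln t" "\<bar>log t b - x\<bar> \<le> M / ln t"
  shows "pm_max (a / b) \<le> exp (2 * M)"
proof -
  have "\<bar>log t a - log t b\<bar> \<le> 2 * M / ln t"
    using assms(4,5) by linarith
  then have "\<bar>ln a - ln b\<bar> / ln t \<le> 2 * M / ln t"
    using assms(1) by (simp add: log_def flip: diff_divide_distrib)
  then have "\<bar>ln a - ln b\<bar> \<le> 2 * M"
    using assms(1) by (simp add: divide_le_cancel)
  then have "exp (ln a - ln b) \<le> exp (2 * M)" "exp (ln b - ln a) \<le> exp (2 * M)"
    by auto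
  then have "a / b \<le> exp (2 * M)" "b / a \<le> exp (2 * M)"
    using assms by (simp_all add: exp_diff)
  then show ?thesis
    by (simp add: pm_max_def)
qed

theorem proposition1p6:
  fixes Q S :: "int set" and \<alpha> \<beta> m p :: nat
    and \<psi> \<phi> :: "int \<Rightarrow> int list \<Rightarrow> int"
    and F G :: rel_maxplus
    and qs :: "int list" and C :: real
  assumes "automaton Q S \<alpha> \<beta> \<psi> \<phi>"
    and "stable_extension Q S \<alpha> \<beta> \<psi> \<phi> F G"
    and "qs \<in> tuples (m + 1) Q"
    and "p > 0"
    and "\<forall>s\<in>seqs S. (aut_comp \<alpha> \<beta> \<psi> \<phi> qs ^^ p) s = s"
    and "C > 0"
  shows "\<exists>t0 > 1. \<exists>D. \<forall>t \<ge> t0. \<forall>k \<in> seqs S. \<forall>z w Z W.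
    (\<forall>i. 0 < z i \<and> inverse C * t powr real_of_int (k i) \<le> z i \<and> z i \<le> C * t powr real_of_int (k i)) \<and>
    (\<forall>j. 0 < w j \<and> inverse C * t powr real_of_int (qs ! (j mod (m + 1))) \<le> w j
         \<and> w j \<le> C * t powr real_of_int (qs ! (j mod (m + 1)))) \<and>
    is_solution \<alpha> \<beta> (elem_eval t F) (elem_eval t G) z w Z W \<longrightarrow>
    (\<forall>i j l. pm_max (Z i j / Z i (j + p * (m + 1) * l)) \<le> D)"
proof -
  obtain \<delta> \<mu> where \<delta>\<mu>: "0 < \<delta>" "0 \<le> \<mu>" "\<mu> < 1"
    and F: "stable_ext_fun \<delta> \<mu> Q S (\<alpha> + 1) \<psi> F" and G: "stable_ext_fun \<delta> \<mu> Q S (\<beta> + 1) \<phi> G"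
    using assms(2) by (auto simp: stable_extension_def)
  define L where "L = max (ln (num_terms F)) (ln (num_terms G))"
  \<comment> \<open>The entry 1 makes \<open>M\<close> positive, \<open>ln C\<close> covers the
    initial values, and \<open>L / (1 - \<mu>)\<close> is the fixed point of the error recursion
    \<open>M\<close> to \<open>L + \<mu> * M\<close>.\<close>
  define M where "M = Max {1, ln C, L / (1 - \<mu>)}"
  have M: "1 \<le> M" "ln C \<le> M" "L / (1 - \<mu>) \<le> M"
    by (simp_all add: M_def)
  have LM: "L + \<mu> * M \<le> M"
    using M(3) \<delta>\<mu> by (simp add: pos_divide_le_eq algebra_simps)
  have qs: "length qs = m + 1" "set qs \<subseteq> Q"
    using assms(3) by (auto simp: tuples_def)
  then have "qs \<noteq> []"
    by auto
  \<comment> \<open>This forces \<open>M / ln t < \<delta>\<close> for \<open>t \<ge> t0\<close>,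
    keeping the orbit where the Lipschitz bounds hold. The summand 1 makes the inequality
    strict.\<close>
  define t0 where "t0 = exp (M / \<delta> + 1)"
  have "t0 > 1"
    using M(1) \<delta>\<mu> by (simp add: t0_def add_pos_pos)
  moreover have "pm_max (Z i j / Z i (j + p * (m + 1) * l)) \<le> exp (2 * M)"
    if "t \<ge> t0" and k: "k \<in> seqs S"
      and z: "\<And>i. 0 < z i \<and> inverse C * t powr real_of_int (k i) \<le> z i \<and> z i \<le> C * t powr real_of_int (k i)"
      and w: "\<And>j. 0 < w j \<and> inverse C * t powr real_of_int (qs ! (j mod (m + 1))) \<le> w j
         \<and> w j \<le> C * t powr real_of_int (qs ! (j mod (m + 1)))"
      and sol: "is_solution \<alpha> \<beta> (elem_eval t F) (elem_eval t G) z w Z W"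
    for t k z w Z W i j l
  proof -
    define e where "e = M / ln t"
    have t: "t > 1" "ln t > 0"
      using \<open>t0 > 1\<close> that(1) by auto
    have "ln t0 \<le> ln t"
      using \<open>t0 > 1\<close> that(1) by simp
    then have "M / \<delta> < ln t"
      by (simp add: t0_def)
    then have e: "e < \<delta>"
      using t \<delta>\<mu> by (simp add: e_def field_simps)
    have C: "log t C \<le> e"
      using M(2) t by (simp add: e_def log_def divide_right_mono)
    \<comment> \<open>Dividing \<open>L + \<mu> * M \<le> M\<close> by \<open>ln t\<close> yields
      the invariance hypotheses \<open>eF\<close> and \<open>eG\<close> of the shadowing
      lemma.\<close>
    have step: "log t (num_terms H) + \<mu> * e \<le> e" if "H = F \<or> H = G" for H
    proof -
      have "ln (num_terms H) + \<mu> * M \<le> M"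
        using LM that by (auto simp: L_def)
      then have "(ln (num_terms H) + \<mu> * M) / ln t \<le> M / ln t"
        using t by (intro divide_right_mono) auto
      then show ?thesis
        by (simp add: e_def log_def add_divide_distrib)
    qed
    have z': "z i > 0 \<and> \<bar>log t (z i) - k i\<bar> \<le> e" for i
      using abs_log_diff_le[OF t(1) assms(6), of "z i" "k i"] z[of i] C by linarith
    have w': "w j > 0 \<and> \<bar>log t (w j) - qs ! (j mod length qs)\<bar> \<le> e" for j
      using abs_log_diff_le[OF t(1) assms(6), of "w j" "qs ! (j mod (m + 1))"] w[of j] C
      unfolding qs(1) by linarith
    note shadow = solution_shadows_automaton[OF assms(1) F G \<delta>\<mu>(1,2) e t(1) step step qs(2)
        \<open>qs \<noteq> []\<close> k sol z' w', simplified]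
    \<comment> \<open>By periodicity the automaton takes this same value at both times, so both
      solution values are within \<open>e\<close> of it in logarithm.\<close>
    define x where "x = periodic_orbit (aut_map \<alpha> \<beta> \<psi> \<phi>) qs k j i"
    have "(fold (aut_map \<alpha> \<beta> \<psi> \<phi>) qs ^^ p) k = k"
      using assms(5) k by (simp add: aut_comp_def)
    from periodic_orbit_period[OF this, of j l]
    have "periodic_orbit (aut_map \<alpha> \<beta> \<psi> \<phi>) qs k (j + p * (m + 1) * l) i = x"
      by (simp only: qs(1) x_def)
    then show ?thesis
      using shadow[of i j] shadow[of i "j + p * (m + 1) * l"] t(1)
      by (intro pm_max_divide_le[of t _ _ "real_of_int x"]) (simp_all only: x_def e_def)
  qed
  ultimately show ?thesis
    by (intro exI[of _ t0] conjI exI[of _ "exp (2 * M)"]) blast+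
qed

end
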